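(* Let $X$ be a bounded lattice and let $M(X)=\mathbb{Z}^{\oplus X}/J$ be the abelian group representing the functor $\mathcal{M}(X,-)$. Then $M(X)$ has a ring structure, induced by the meet operation of $X$ (that is, determined by $[x]\cdot[y]=[x\wedge y]$ for $x,y\in X$), and as a ring it is isomorphic to $\mathbb{Z}[X]/I$. The ring structure on $M(X)$ is functorial in $X$: every morphism of bounded lattices $f:X\to X'$ induces a ring homomorphism $f_*:M(X)\to M(X')$, $[x]\mapsto[f(x)]$.
   Context: All rings are commutative with identity. A bounded lattice $X$ has a least element $0_X$ and a greatest element $1_X$; a morphism of bounded lattices preserves $\wedge$, $\vee$, $0$ and $1$. For an abelian group $B$, a ($B$-valued) measure on $X$ is a function $\nu:X\to B$ with $\nu(0_X)=0$ and, for all $k\ge 2$ and all $x_1,\dots,x_k\in X$, \[ \nu(x_1\vee\dots\vee x_k)=\sum_{s=1}^k(-1)^{s+1}\sum_{1\leq i_1<\dots<i_s\leq k}\nu(x_{i_1}\wedge\dots\wedge x_{i_s}); \] $\mathcal{M}(X,B)$ is the abelian group of all such measures. $\mathbb{Z}^{\oplus X}$ is the free abelian group on the set $X$ and $J$ is its subgroup generated by $0_X$ and all elements \[ x_1\vee\dots\vee x_k-\sum_{s=1}^k(-1)^{s+1}\sum_{1\leq i_1<\dots<i_s\leq k}x_{i_1}\wedge\dots\wedge x_{i_s},\qquad k\ge2,\ x_1,\dots,x_k\in X. \] $[x]$ denotes the class of $x\in X$ in $M(X)=\mathbb{Z}^{\oplus X}/J$; this group represents $\mathcal{M}(X,-)$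 on abelian groups. $\mathbb{Z}[X]$ is the polynomial ring with one variable for each element of $X$, and $I\subseteq\mathbb{Z}[X]$ is the ideal generated by $0_X$, $1_X-1$, and $x\wedge y-xy$, $x\vee y-x-y+xy$ for all $x,y\in X$. *)

theory Defs
  imports "HOL-Algebra.Free_Abelian_Groups" "HOL-Algebra.QuotRing"
    "HOL-Algebra.Algebraic_Closure_Type"
begin

text \<open>
  The bounded lattice \<open>X\<close> is a type of class \<^class>\<open>bounded_lattice\<close>; neither distributivity nor
  \<open>bot \<noteq> top\<close> is assumed.
  A choice of indices \<open>i\<^sub>1 < \<dots> < i\<^sub>s\<close> in \<open>{1..k}\<close> is encoded as a subset \<open>I\<close> of cardinality \<open>s\<close>.
\<close>

definition lattice_relations :: "('a::bounded_lattice \<Rightarrow>\<^sub>0 int) set" where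
  "lattice_relations =
     {frag_of bot} \<union>
     {frag_of (Sup_fin (x ` {1..k})) -
        (\<Sum>s=1..k. frag_cmul ((-1) ^ (s + 1))
           (\<Sum>I | I \<subseteq> {1..k} \<and> card I = s. frag_of (Inf_fin (x ` I))))
      | (k::nat) (x::nat \<Rightarrow> 'a). k \<ge> 2}"

definition lattice_J :: "('a::bounded_lattice \<Rightarrow>\<^sub>0 int) set" where
  "lattice_J = generate (free_Abelian_group UNIV) lattice_relations"

definition lattice_M :: "('a::bounded_lattice \<Rightarrow>\<^sub>0 int) set monoid" where
  "lattice_M = free_Abelian_group UNIV Mod lattice_J"

definition lattice_M_class :: "'a::bounded_lattice \<Rightarrow> ('a \<Rightarrow>\<^sub>0 int) set" where
  "lattice_M_class x = lattice_J #>\<^bsub>free_Abelian_group UNIV\<^esub> frag_of x"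

text \<open>The abelian group \<open>B\<close> is written multiplicatively, as always in \<^theory>\<open>HOL-Algebra.Group\<close>.\<close>

definition lattice_measure :: "('b, 'm) monoid_scheme \<Rightarrow> ('a::bounded_lattice \<Rightarrow> 'b) \<Rightarrow> bool" where
  "lattice_measure B \<nu> \<longleftrightarrow>
     range \<nu> \<subseteq> carrier B \<and> \<nu> bot = \<one>\<^bsub>B\<^esub> \<and>
     (\<forall>(k::nat) (x::nat \<Rightarrow> 'a). k \<ge> 2 \<longrightarrow>
        \<nu> (Sup_fin (x ` {1..k})) =
        finprod B (\<lambda>s. finprod B (\<lambda>I. \<nu> (Inf_fin (x ` I))) {I. I \<subseteq> {1..k} \<and> card I = s}
          [^]\<^bsub>B\<^esub> ((-1) ^ (s + 1) :: int)) {1..k})"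

text \<open>
  A ring structure on the abelian group \<^const>\<open>lattice_M\<close> whose multiplication is induced by meet.
  Its unit is not prescribed.
\<close>

definition meet_ring_structure :: "('a::bounded_lattice \<Rightarrow>\<^sub>0 int) set ring \<Rightarrow> bool" where
  "meet_ring_structure R \<longleftrightarrow>
     cring R \<and> add_monoid R = lattice_M \<and>
     (\<forall>x y. lattice_M_class x \<otimes>\<^bsub>R\<^esub> lattice_M_class y = lattice_M_class (inf x y))"

text \<open>\<open>\<int>[X]\<close>: monomials are the finitely supported exponent functions \<open>X \<Rightarrow>\<^sub>0 nat\<close>.\<close>

type_synonym 'a int_mpoly = "('a \<Rightarrow>\<^sub>0 nat) \<Rightarrow>\<^sub>0 int"

definition int_var :: "'a \<Rightarrow> 'a int_mpoly" where
  "int_var x = Poly_Mapping.single (Poly_Mapping.single x 1) 1"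

definition int_mpoly_ring :: "'a int_mpoly ring" where
  "int_mpoly_ring = ring_of_type_algebra"

definition lattice_ideal :: "'a::bounded_lattice int_mpoly set" where
  "lattice_ideal = Idl\<^bsub>int_mpoly_ring\<^esub>
     ({int_var bot, int_var Orderings.top - 1} \<union>
      {int_var (inf x y) - int_var x * int_var y | x y. True} \<union>
      {int_var (sup x y) - int_var x - int_var y + int_var x * int_var y | x y. True})"

definition bounded_lattice_hom :: "('a::bounded_lattice \<Rightarrow> 'b::bounded_lattice) \<Rightarrow> bool" where
  "bounded_lattice_hom f \<longleftrightarrow>
     f bot = bot \<and> f Orderings.top = Orderings.top \<and>
     (\<forall>x y. f (inf x y) = inf (f x) (f y)) \<and> (\<forall>x y. f (sup x y) = sup (f x) (f y))"

text \<open>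
  The map on quotients induced by the \<open>\<int>\<close>-linear extension of \<open>f\<close>, in the style of
  \<^const>\<open>rcoset_mult\<close>: if the linear extension maps \<open>J\<close> into \<open>J\<close>, all members of the union coincide.
\<close>

definition lattice_M_map ::
    "('a::bounded_lattice \<Rightarrow> 'b::bounded_lattice) \<Rightarrow> ('a \<Rightarrow>\<^sub>0 int) set \<Rightarrow> ('b \<Rightarrow>\<^sub>0 int) set" where
  "lattice_M_map f C =
     (\<Union>c\<in>C. lattice_J #>\<^bsub>free_Abelian_group UNIV\<^esub> frag_extend (\<lambda>x. frag_of (f x)) c)"

lemma lattice_relations_carrier: "lattice_relations \<subseteq> carrier (free_Abelian_group UNIV)"
  by auto

lemma lattice_J_normal: "lattice_J \<lhd> free_Abelian_group UNIV"
  unfolding lattice_J_def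
  by (intro comm_group.subgroup_imp_normal abelian_free_Abelian_group group.generate_is_subgroup
      group_free_Abelian_group lattice_relations_carrier)

lemma hom_free_sum:
  assumes B: "comm_group B" and h: "h \<in> hom (free_Abelian_group UNIV) B"
    and "finite A"
  shows "h (sum c A) = finprod B (\<lambda>i. h (c i)) A"
proof -
  interpret B: comm_group B by (rule B)
  have c: "h y \<in> carrier B" for y
    using h by (auto simp: hom_def Pi_def)
  show ?thesis
    using \<open>finite A\<close>
  proof (induction A)
    case empty
    then show ?case
      using hom_one[OF h group_free_Abelian_group B.is_group] by simp
  next
    case (insert a A)
    have "h (c a + sum c A) = h (c a) \<otimes>\<^bsub>B\<^esub> h (sum c A)"
      using hom_mult[OF h, of "c a" "sum c A"] by simp
    with insert c show ?case by (simp add: Pi_def)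
  qed
qed

lemma hom_relation:
  assumes B: "comm_group B" and h: "h \<in> hom (free_Abelian_group UNIV) B"
    and \<nu>: "\<And>x. h (frag_of x) = \<nu> x"
  shows "h (\<Sum>s=1..k::nat. frag_cmul ((-1) ^ (s + 1))
           (\<Sum>I | I \<subseteq> {1..k} \<and> card I = s. frag_of (Inf_fin (x ` I)))) =
         finprod B (\<lambda>s. finprod B (\<lambda>I. \<nu> (Inf_fin (x ` I))) {I. I \<subseteq> {1..k} \<and> card I = s}
           [^]\<^bsub>B\<^esub> ((-1) ^ (s + 1) :: int)) {1..k}"
proof -
  interpret B: comm_group B by (rule B)
  interpret gh: group_hom "free_Abelian_group UNIV" B h
    by (simp add: group_hom_def group_hom_axioms_def h B.is_group)
  have p: "h (frag_cmul n y) = h y [^]\<^bsub>B\<^esub> n" for n y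
    using gh.hom_int_pow[of y n] by simp
  have fin: "finite {I. I \<subseteq> {1..k} \<and> card I = s}" for s
    by (rule finite_subset[of _ "Pow {1..k}"]) auto
  have q: "h (\<Sum>I | I \<subseteq> {1..k} \<and> card I = s. frag_of (Inf_fin (x ` I))) =
      finprod B (\<lambda>I. \<nu> (Inf_fin (x ` I))) {I. I \<subseteq> {1..k} \<and> card I = s}" for s
    by (subst hom_free_sum[OF B h fin]) (simp add: \<nu>)
  show ?thesis
    by (subst hom_free_sum[OF B h]) (simp_all only: p q finite_atLeastAtMost)
qed

text \<open>
  \<^const>\<open>lattice_M\<close> represents \<open>\<M>(X,-)\<close>: composition with \<^const>\<open>lattice_M_class\<close> is a bijection from
  homomorphisms to measures.
\<close>

lemma lattice_measure_of_hom:
  fixes g :: "('a::bounded_lattice \<Rightarrow>\<^sub>0 int) set \<Rightarrow> 'b"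
  assumes B: "comm_group B" and g: "g \<in> hom lattice_M B"
  shows "lattice_measure B (\<lambda>x. g (lattice_M_class x))"
proof -
  let ?F = "free_Abelian_group UNIV :: ('a \<Rightarrow>\<^sub>0 int) monoid"
  interpret B: comm_group B by (rule B)
  define h where "h = (\<lambda>c. g (lattice_J #>\<^bsub>?F\<^esub> c))"
  have h: "h \<in> hom ?F B"
    using hom_compose[OF normal.r_coset_hom_Mod[OF lattice_J_normal] g[unfolded lattice_M_def]]
    by (simp add: h_def comp_def)
  have \<nu>: "h (frag_of x) = g (lattice_M_class x)" for x
    by (simp add: h_def lattice_M_class_def)
  have J: "h c = \<one>\<^bsub>B\<^esub>" if "c \<in> lattice_relations" for c
  proof -
    have "c \<in> lattice_J"
      unfolding lattice_J_def using that by (rule generate.incl)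
    then have "lattice_J #>\<^bsub>?F\<^esub> c = lattice_J #>\<^bsub>?F\<^esub> \<one>\<^bsub>?F\<^esub>"
      by (metis group.coset_join2 group_free_Abelian_group carrier_free_Abelian_group_iff
          lattice_J_normal normal_imp_subgroup subgroup.one_closed subset_UNIV)
    then have "h c = h \<one>\<^bsub>?F\<^esub>"
      by (simp add: h_def)
    then show ?thesis
      using hom_one[OF h group_free_Abelian_group B.is_group] by simp
  qed
  have c: "h y \<in> carrier B" for y
    using h by (auto simp: hom_def Pi_def)
  have eq: "h a = h b" if "a - b \<in> lattice_relations" for a b
    using hom_mult[OF h, of "a - b" b] J[OF that] c[of b] by simp
  show ?thesis
    unfolding lattice_measure_def
  proof (intro conjI allI impI)
    show "range (\<lambda>x. g (lattice_M_class x)) \<subseteq> carrier B"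
      using c by (auto simp flip: \<nu>)
    show "g (lattice_M_class bot) = \<one>\<^bsub>B\<^esub>"
      using J[of "frag_of bot"] by (simp add: \<nu> lattice_relations_def)
    fix k :: nat and x :: "nat \<Rightarrow> 'a" assume "2 \<le> k"
    then have "h (frag_of (Sup_fin (x ` {1..k}))) = h (\<Sum>s=1..k. frag_cmul ((-1) ^ (s + 1))
           (\<Sum>I | I \<subseteq> {1..k} \<and> card I = s. frag_of (Inf_fin (x ` I))))"
      by (intro eq) (auto simp: lattice_relations_def)
    then show "g (lattice_M_class (Sup_fin (x ` {1..k}))) =
        finprod B (\<lambda>s. finprod B (\<lambda>I. g (lattice_M_class (Inf_fin (x ` I))))
          {I. I \<subseteq> {1..k} \<and> card I = s} [^]\<^bsub>B\<^esub> ((-1) ^ (s + 1) :: int)) {1..k}"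
      unfolding hom_relation[OF B h \<nu>] \<nu> .
  qed
qed

lemma lattice_M_represents:
  fixes \<nu> :: "'a::bounded_lattice \<Rightarrow> 'b"
  assumes B: "comm_group B" and m: "lattice_measure B \<nu>"
  shows "\<exists>!g. g \<in> hom lattice_M B \<and> g \<in> extensional (carrier lattice_M) \<and>
           (\<forall>x. g (lattice_M_class x) = \<nu> x)"
proof -
  let ?F = "free_Abelian_group UNIV :: ('a \<Rightarrow>\<^sub>0 int) monoid"
  interpret B: comm_group B by (rule B)
  have J_group: "group (lattice_M :: ('a \<Rightarrow>\<^sub>0 int) set monoid)"
    unfolding lattice_M_def by (rule normal.factorgroup_is_group[OF lattice_J_normal])
  obtain h where h: "h \<in> hom ?F B" and h\<nu>: "\<And>x. h (frag_of x) = \<nu> x"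
    using B.free_Abelian_group_universal[of \<nu> UNIV] m
    unfolding lattice_measure_def by (metis UNIV_I)
  interpret gh: group_hom ?F B h
    by (simp add: group_hom_def group_hom_axioms_def h B.is_group)
  have sub: "lattice_J \<subseteq> kernel ?F B h"
    unfolding lattice_J_def
  proof (rule group.generate_subgroup_incl[OF group_free_Abelian_group _ gh.subgroup_kernel], rule)
    fix c :: "'a \<Rightarrow>\<^sub>0 int" assume c: "c \<in> lattice_relations"
    have "h c = \<one>\<^bsub>B\<^esub>"
    proof (cases "c = frag_of bot")
      case True
      then show ?thesis using m by (simp add: h\<nu> lattice_measure_def)
    next
      case False
      with c obtain k and x :: "nat \<Rightarrow> 'a" where k: "k \<ge> (2::nat)" and
        c': "c = frag_of (Sup_fin (x ` {1..k})) - (\<Sum>s=1..k. frag_cmul ((-1) ^ (s + 1))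
           (\<Sum>I | I \<subseteq> {1..k} \<and> card I = s. frag_of (Inf_fin (x ` I))))" (is "_ = ?a - ?b")
        unfolding lattice_relations_def by blast
      have "h ?a = h ?b"
        unfolding hom_relation[OF B h h\<nu>] h\<nu>
        using m k unfolding lattice_measure_def by blast
      moreover have "h ?a = h c \<otimes>\<^bsub>B\<^esub> h ?b"
        using gh.hom_mult[of c ?b] by (simp add: c')
      ultimately have "h c \<otimes>\<^bsub>B\<^esub> h ?b = \<one>\<^bsub>B\<^esub> \<otimes>\<^bsub>B\<^esub> h ?b"
        using gh.hom_closed[of ?b] by simp
      then show ?thesis
        by (rule B.right_cancel[THEN iffD1, rotated -1]) (auto intro!: gh.hom_closed)
    qed
    then show "c \<in> kernel ?F B h"
      by (simp add: kernel_def)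
  qed
  obtain g where g: "g \<in> hom (?F Mod lattice_J) B"
    and gh: "\<And>c. c \<in> carrier ?F \<Longrightarrow> g (lattice_J #>\<^bsub>?F\<^esub> c) = h c"
    using gh.FactGroup_universal_kernel[OF lattice_J_normal sub] by blast
  have cls: "lattice_M_class x \<in> carrier lattice_M" for x :: 'a
    by (auto simp: lattice_M_class_def lattice_M_def carrier_FactGroup)
  show ?thesis
  proof (rule ex_ex1I)
    have "restrict g (carrier lattice_M) \<in> hom lattice_M B"
      using g[folded lattice_M_def] J_group
      by (auto simp: hom_def group.is_monoid monoid.m_closed)
    moreover have "restrict g (carrier lattice_M) (lattice_M_class x) = \<nu> x" for x
      using cls[of x] gh[of "frag_of x"] by (simp add: lattice_M_class_def h\<nu>)
    ultimately show "\<exists>g. g \<in> hom lattice_M B \<and> g \<in> extensional (carrier lattice_M) \<and>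
        (\<forall>x. g (lattice_M_class x) = \<nu> x)"
      by blast
  next
    fix g1 g2 :: "('a \<Rightarrow>\<^sub>0 int) set \<Rightarrow> 'b"
    assume 1: "g1 \<in> hom lattice_M B \<and> g1 \<in> extensional (carrier lattice_M) \<and>
        (\<forall>x. g1 (lattice_M_class x) = \<nu> x)"
      and 2: "g2 \<in> hom lattice_M B \<and> g2 \<in> extensional (carrier lattice_M) \<and>
        (\<forall>x. g2 (lattice_M_class x) = \<nu> x)"
    have hom: "(\<lambda>c. g' (lattice_J #>\<^bsub>?F\<^esub> c)) \<in> hom ?F B" if "g' \<in> hom lattice_M B" for g'
      using hom_compose[OF normal.r_coset_hom_Mod[OF lattice_J_normal] that[unfolded lattice_M_def]]
      by (simp add: comp_def)
    interpret h1: group_hom ?F B "\<lambda>c. g1 (lattice_J #>\<^bsub>?F\<^esub> c)"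
      using hom[of g1] 1 by (simp add: group_hom_def group_hom_axioms_def B.is_group)
    interpret h2: group_hom ?F B "\<lambda>c. g2 (lattice_J #>\<^bsub>?F\<^esub> c)"
      using hom[of g2] 2 by (simp add: group_hom_def group_hom_axioms_def B.is_group)
    have "g1 (lattice_J #>\<^bsub>?F\<^esub> c) = g2 (lattice_J #>\<^bsub>?F\<^esub> c)" for c
    proof (induction c rule: free_Abelian_group_induct[where S = UNIV])
      case 1
      then show ?case by simp
    next
      case 2
      then show ?case using h1.hom_one h2.hom_one by simp
    next
      case (3 x y)
      have "x - y = x \<otimes>\<^bsub>?F\<^esub> inv\<^bsub>?F\<^esub> y" by simp
      with 3 show ?case
        by (simp only: h1.hom_mult h2.hom_mult h1.hom_inv h2.hom_inv group.inv_closed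
            group_free_Abelian_group carrier_free_Abelian_group_iff subset_UNIV)
    next
      case (4 a)
      then show ?case using 1 2 by (simp flip: lattice_M_class_def)
    qed
    then have "g1 C = g2 C" if "C \<in> carrier lattice_M" for C
      using that by (auto simp: lattice_M_def carrier_FactGroup)
    then show "g1 = g2"
      using 1 2 by (meson extensionalityI)
  qed
qed

end

theory Submission
  imports Defs
begin

text \<open>
  \<open>\<int>\<^sup>\<oplus>\<^sup>X\<close> is the monoid ring of \<open>(X, \<sqinter>, \<top>)\<close>, and the point is that \<open>J\<close> is an ideal of it although \<open>X\<close>
  is not assumed distributive. Write \<open>D\<^sub>k\<close> for the difference between the join \<open>s\<close> of \<open>x\<^sub>1, \<dots>, x\<^sub>k\<close> and
  their inclusion-exclusion sum; then, for \<open>x\<^sub>k\<^sub>+\<^sub>1 = y\<close>,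
  \<open>D\<^sub>k\<^sub>+\<^sub>1 = (y \<squnion> s - y - s + y \<sqinter> s) + D\<^sub>k - y \<sqinter> D\<^sub>k\<close>. All terms other than \<open>y \<sqinter> D\<^sub>k\<close> are known to lie
  in \<open>J\<close>, hence so does \<open>y \<sqinter> D\<^sub>k\<close>. Read as a recursion for \<open>D\<^sub>k\<close>, the same identity shows that \<open>J\<close> is the
  ideal generated by the least element and the relations with \<open>k = 2\<close>.

  Sending a monomial to the meet of its variables is a surjective ring homomorphism from \<open>\<int>[X]\<close> to
  \<open>\<int>\<^sup>\<oplus>\<^sup>X\<close> and takes the generators of \<open>I\<close> into \<open>J\<close>. The linear map sending each element of \<open>X\<close> to its
  variable is a section of it; modulo \<open>I\<close> this section is multiplicative and a two-sided inverse, and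
  it takes the generators of \<open>J\<close> into \<open>I\<close>. Hence \<open>I\<close> is exactly the preimage of \<open>J\<close>.
\<close>

subsection \<open>Linear and bilinear extension of maps\<close>

definition frag_map :: "('a \<Rightarrow> 'b) \<Rightarrow> ('a \<Rightarrow>\<^sub>0 int) \<Rightarrow> ('b \<Rightarrow>\<^sub>0 int)" where
  "frag_map h = frag_extend (\<lambda>x. frag_of (h x))"

definition frag_map2 :: "('a \<Rightarrow> 'b \<Rightarrow> 'c) \<Rightarrow> ('a \<Rightarrow>\<^sub>0 int) \<Rightarrow> ('b \<Rightarrow>\<^sub>0 int) \<Rightarrow> ('c \<Rightarrow>\<^sub>0 int)" where
  "frag_map2 f a b = frag_extend (\<lambda>x. frag_map (f x) b) a"

lemma additive_frag_eqI:
  fixes F G :: "('a \<Rightarrow>\<^sub>0 int) \<Rightarrow> 'b::ab_group_add"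
  assumes "additive F" "additive G" and "\<And>x. F (frag_of x) = G (frag_of x)"
  shows "F c = G c"
  by (rule frag_induction[of c UNIV]) (simp_all add: assms additive.zero additive.diff)

lemma frag_extend_frag_extend:
  "frag_extend f (frag_extend g c) = frag_extend (\<lambda>x. frag_extend f (g x)) c"
  by (rule additive_frag_eqI[where c = c]) (simp_all add: additive_def frag_extend_add)

lemma frag_extend_add_fun:
  "frag_extend (\<lambda>x. f x + g x) c = frag_extend f c + frag_extend g c"
  by (rule additive_frag_eqI[where c = c]) (simp_all add: additive_def frag_extend_add)

lemma frag_extend_mult_left:
  fixes p :: "'m::monoid_add \<Rightarrow>\<^sub>0 int"
  shows "frag_extend (\<lambda>x. p * f x) c = p * frag_extend f c"
  by (rule additive_frag_eqI[where c = c])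
    (simp_all add: additive_def frag_extend_add distrib_left)

lemma frag_map_of [simp]: "frag_map h (frag_of x) = frag_of (h x)"
  by (simp add: frag_map_def)

lemma frag_map_add: "frag_map h (a + b) = frag_map h a + frag_map h b"
  by (simp add: frag_map_def frag_extend_add)

lemma frag_map_diff: "frag_map h (a - b) = frag_map h a - frag_map h b"
  by (simp add: frag_map_def frag_extend_diff)

lemma frag_map_eq_self: "(\<And>x. h x = x) \<Longrightarrow> frag_map h c = c"
  by (simp add: frag_map_def flip: frag_expansion)

lemma frag_extend_frag_map: "frag_extend f (frag_map h c) = frag_extend (\<lambda>x. f (h x)) c"
  by (simp add: frag_map_def frag_extend_frag_extend)

lemma frag_map_frag_extend: "frag_map h (frag_extend f c) = frag_extend (\<lambda>x. frag_map h (f x)) c"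
  by (simp add: frag_map_def frag_extend_frag_extend)

lemma frag_map_frag_map: "frag_map g (frag_map h c) = frag_map (\<lambda>x. g (h x)) c"
  by (simp add: frag_map_def frag_extend_frag_extend)

lemma frag_map2_of_left [simp]: "frag_map2 f (frag_of x) b = frag_map (f x) b"
  by (simp add: frag_map2_def)

lemma frag_map2_add_left: "frag_map2 f (a + b) c = frag_map2 f a c + frag_map2 f b c"
  by (simp add: frag_map2_def frag_extend_add)

lemma frag_map2_add_right: "frag_map2 f c (a + b) = frag_map2 f c a + frag_map2 f c b"
  by (simp add: frag_map2_def frag_map_add frag_extend_add_fun)

lemma frag_map2_diff_left: "frag_map2 f (a - b) c = frag_map2 f a c - frag_map2 f b c"
  by (simp add: frag_map2_def frag_extend_diff)

lemma frag_map2_swap: "frag_map2 f a b = frag_map2 (\<lambda>y x. f x y) b a"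
proof (rule additive_frag_eqI[where c = a])
  show "frag_map2 f (frag_of x) b = frag_map2 (\<lambda>y x. f x y) b (frag_of x)" for x
    by (simp add: frag_map2_def frag_map_def)
qed (simp_all add: additive_def frag_map2_add_left frag_map2_add_right)

lemma frag_map2_assoc:
  assumes "\<And>x y z. f (f x y) z = f x (f y z)"
  shows "frag_map2 f (frag_map2 f a b) c = frag_map2 f a (frag_map2 f b c)"
  by (simp add: frag_map2_def frag_map_def frag_extend_frag_extend assms)

lemma frag_map_frag_map2:
  assumes "\<And>x y. h (f x y) = g (h x) (h y)"
  shows "frag_map h (frag_map2 f a b) = frag_map2 g (frag_map h a) (frag_map h b)"
  by (simp add: frag_map2_def frag_map_def frag_extend_frag_extend assms)

lemma times_eq_frag_map2:
  fixes p q :: "'m::monoid_add \<Rightarrow>\<^sub>0 int"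
  shows "p * q = frag_map2 (+) p q"
proof (rule additive_frag_eqI[where c = p])
  show "frag_of m * q = frag_map2 (+) (frag_of m) q" for m
    by (rule additive_frag_eqI[where c = q])
      (simp_all add: additive_def distrib_left frag_map_add mult_single)
qed (simp_all add: additive_def distrib_right frag_map2_add_left)

subsection \<open>Subgroups of free abelian groups\<close>

locale frag_subgroup =
  fixes H :: "('a \<Rightarrow>\<^sub>0 int) set"
  assumes subgroup_free_Abelian_group: "subgroup H (free_Abelian_group UNIV)"
begin

lemma zero_mem: "0 \<in> H"
  using subgroup.one_closed[OF subgroup_free_Abelian_group] by simp

lemma add_mem: "a \<in> H \<Longrightarrow> b \<in> H \<Longrightarrow> a + b \<in> H"
  using subgroup.m_closed[OF subgroup_free_Abelian_group, of a b] by simp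

lemma uminus_mem: "a \<in> H \<Longrightarrow> - a \<in> H"
  using subgroup.m_inv_closed[OF subgroup_free_Abelian_group, of a] by simp

lemma diff_mem: "a \<in> H \<Longrightarrow> b \<in> H \<Longrightarrow> a - b \<in> H"
  using add_mem[of a "- b"] uminus_mem[of b] by simp

lemma diff_mem_imp_mem_iff: "a - b \<in> H \<Longrightarrow> a \<in> H \<longleftrightarrow> b \<in> H"
  using add_mem[of "a - b" b] diff_mem[of a "a - b"] by auto

lemma frag_extend_mem:
  assumes "\<And>x. f x \<in> H"
  shows "frag_extend f c \<in> H"
  by (rule frag_induction[of c UNIV]) (auto simp: assms zero_mem frag_extend_diff diff_mem)

lemma frag_extend_diff_mem:
  assumes "\<And>x. f x - g x \<in> H"
  shows "frag_extend f c - frag_extend g c \<in> H"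
  using frag_extend_mem[OF assms] frag_extend_add_fun[of "\<lambda>x. f x - g x" g c]
  by (simp add: eq_diff_eq)

lemma frag_subgroup_vimage: "frag_subgroup {c. frag_extend f c \<in> H}"
proof (rule frag_subgroup.intro)
  show "subgroup {c. frag_extend f c \<in> H} (free_Abelian_group UNIV)"
    by (rule group.subgroupI)
      (auto simp: zero_mem frag_extend_minus uminus_mem frag_extend_add add_mem intro: exI[of _ 0])
qed

lemma rcoset_eq_iff:
  "H #>\<^bsub>free_Abelian_group UNIV\<^esub> a = H #>\<^bsub>free_Abelian_group UNIV\<^esub> b \<longleftrightarrow> a - b \<in> H"
proof -
  have mem: "c \<in> H #>\<^bsub>free_Abelian_group UNIV\<^esub> b \<longleftrightarrow> c - b \<in> H" for b c
    using subgroup.rcos_module[OF subgroup_free_Abelian_group, of b c] by simp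
  have "c - a \<in> H \<longleftrightarrow> c - b \<in> H" if "a - b \<in> H" for c
    using diff_mem_imp_mem_iff[of "c - b" "c - a"] that by simp
  then show ?thesis
    using mem[of a a] mem[of a b] zero_mem by (auto simp: mem)
qed

end

subsection \<open>The integral monoid ring\<close>

definition int_monoid_ring :: "('a \<Rightarrow> 'a \<Rightarrow> 'a) \<Rightarrow> 'a \<Rightarrow> ('a \<Rightarrow>\<^sub>0 int) ring" where
  "int_monoid_ring f e = \<lparr>carrier = UNIV, monoid.mult = frag_map2 f, one = frag_of e,
     ring.zero = 0, add = (+)\<rparr>"

lemma int_monoid_ring_simps [simp]:
  "carrier (int_monoid_ring f e) = UNIV"
  "a \<otimes>\<^bsub>int_monoid_ring f e\<^esub> b = frag_map2 f a b"
  "\<one>\<^bsub>int_monoid_ring f e\<^esub> = frag_of e"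
  "\<zero>\<^bsub>int_monoid_ring f e\<^esub> = 0"
  "a \<oplus>\<^bsub>int_monoid_ring f e\<^esub> b = a + b"
  by (simp_all add: int_monoid_ring_def)

lemma add_monoid_int_monoid_ring:
  "add_monoid (int_monoid_ring f e) = free_Abelian_group UNIV"
  by (simp add: int_monoid_ring_def free_Abelian_group_def)

lemma cring_int_monoid_ring:
  assumes "Groups.comm_monoid f e"
  shows "cring (int_monoid_ring f e)"
proof -
  interpret f: Groups.comm_monoid f e by fact
  have commute: "frag_map2 f a b = frag_map2 f b a" for a b
    using frag_map2_swap[of f a b] by (simp add: f.commute)
  show ?thesis
  proof (rule cringI)
    show "abelian_group (int_monoid_ring f e)"
      by (rule abelian_groupI) (auto simp: ac_simps intro: exI[of _ "- x" for x])
    show "Group.comm_monoid (int_monoid_ring f e)"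
      by (rule comm_monoidI) (simp_all add: frag_map2_assoc f.assoc frag_map_eq_self, rule commute)
  qed (simp add: frag_map2_add_left)
qed

lemma ring_hom_ring_frag_map:
  assumes "Groups.comm_monoid f e" "Groups.comm_monoid g e'"
    and "h e = e'" "\<And>x y. h (f x y) = g (h x) (h y)"
  shows "ring_hom_ring (int_monoid_ring f e) (int_monoid_ring g e') (frag_map h)"
  by (rule ring_hom_ringI)
    (simp_all add: assms cring.axioms(1) cring_int_monoid_ring frag_map_add frag_map_frag_map2)

lemma ideal_imp_frag_subgroup: "ideal H (int_monoid_ring f e) \<Longrightarrow> frag_subgroup H"
  unfolding frag_subgroup_def add_monoid_int_monoid_ring[of f e, symmetric]
  by (intro additive_subgroup.a_subgroup ideal.axioms(1))

lemma ideal_int_monoid_ring_iff: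
  assumes "Groups.comm_monoid f e"
  shows "ideal H (int_monoid_ring f e) \<longleftrightarrow> frag_subgroup H \<and> (\<forall>x. \<forall>c\<in>H. frag_map (f x) c \<in> H)"
    (is "_ \<longleftrightarrow> _ \<and> ?closed")
proof (intro iffI conjI; (elim conjE)?)
  assume H: "ideal H (int_monoid_ring f e)"
  then show "frag_subgroup H"
    by (rule ideal_imp_frag_subgroup)
  show ?closed
    using ideal.I_l_closed[OF H, of _ "frag_of x" for x] by simp
next
  assume H: "frag_subgroup H" and closed: ?closed
  interpret cring "int_monoid_ring f e"
    using assms by (rule cring_int_monoid_ring)
  have "frag_map2 f a c \<in> H" if "c \<in> H" for a c
    unfolding frag_map2_def using that closed by (intro frag_subgroup.frag_extend_mem[OF H]) simp
  then show "ideal H (int_monoid_ring f e)"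
    using frag_subgroup.subgroup_free_Abelian_group[OF H] m_comm
    by (intro idealI ring_axioms, unfold add_monoid_int_monoid_ring) simp_all
qed

subsection \<open>Inclusion-exclusion\<close>

definition incl_excl :: "('i \<Rightarrow> 'a::semilattice_inf) \<Rightarrow> 'i set \<Rightarrow> ('a \<Rightarrow>\<^sub>0 int)" where
  "incl_excl x A =
     (\<Sum>I\<in>Pow A - {{}}. frag_cmul ((-1) ^ (card I + 1)) (frag_of (Inf_fin (x ` I))))"

definition incl_excl_defect :: "('i \<Rightarrow> 'a::lattice) \<Rightarrow> 'i set \<Rightarrow> ('a \<Rightarrow>\<^sub>0 int)" where
  "incl_excl_defect x A = frag_of (Sup_fin (x ` A)) - incl_excl x A"

definition modular_defect :: "'a::lattice \<Rightarrow> 'a \<Rightarrow> ('a \<Rightarrow>\<^sub>0 int)" where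
  "modular_defect x y = frag_of (sup x y) - frag_of x - frag_of y + frag_of (inf x y)"

lemma incl_excl_by_card:
  assumes "finite A"
  shows "(\<Sum>s=1..card A. frag_cmul ((-1) ^ (s + 1))
      (\<Sum>I | I \<subseteq> A \<and> card I = s. frag_of (Inf_fin (x ` I)))) = incl_excl x A"
proof -
  let ?g = "\<lambda>I. frag_cmul ((-1) ^ (card I + 1)) (frag_of (Inf_fin (x ` I)))"
  have "card I \<in> {1..card A}" if I: "I \<in> Pow A - {{}}" for I
  proof -
    have "finite I"
      using I assms by (auto intro: finite_subset)
    then show ?thesis
      using I assms by (auto simp: Suc_le_eq card_gt_0_iff intro: card_mono)
  qed
  then have "card ` (Pow A - {{}}) \<subseteq> {1..card A}"
    by (rule image_subsetI)
  then have "incl_excl x A = (\<Sum>s=1..card A. \<Sum>I | I \<in> Pow A - {{}} \<and> card I = s. ?g I)"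
    unfolding incl_excl_def using assms by (intro sum.group[symmetric]) auto
  also have "\<dots> = (\<Sum>s=1..card A. \<Sum>I | I \<subseteq> A \<and> card I = s. ?g I)"
    by (intro sum.cong refl) auto
  finally show ?thesis
    by (simp add: frag_cmul_sum)
qed

lemma incl_excl_singleton [simp]: "incl_excl x {a} = frag_of (x a)"
proof -
  have "Pow {a} - {{}} = {{a}}" by auto
  then show ?thesis
    by (simp add: incl_excl_def)
qed

lemma incl_excl_insert:
  assumes "finite A" "a \<notin> A"
  shows "incl_excl x (insert a A) =
    incl_excl x A + frag_of (x a) - frag_map (inf (x a)) (incl_excl x A)"
proof -
  let ?g = "\<lambda>I. frag_cmul ((-1) ^ (card I + 1)) (frag_of (Inf_fin (x ` I)))"
  let ?P = "Pow A - {{}}"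
  have split: "Pow (insert a A) - {{}} = insert {a} (?P \<union> insert a ` ?P)"
    unfolding Pow_insert by auto
  have inj: "inj_on (insert a) ?P"
    using assms by (intro inj_onI) (metis DiffD1 PowD insert_ident subsetD)
  have g_insert: "?g (insert a I) = - frag_map (inf (x a)) (?g I)" if "I \<in> ?P" for I
  proof -
    have "finite I" "I \<noteq> {}" "a \<notin> I"
      using that assms finite_subset[of I A] by auto
    then show ?thesis
      by (simp add: frag_map_def frag_extend_cmul)
  qed
  have "{a} \<notin> ?P \<union> insert a ` ?P" "?P \<inter> insert a ` ?P = {}"
    using assms by auto
  then have "incl_excl x (insert a A) = ?g {a} + (sum ?g ?P + sum ?g (insert a ` ?P))"
    unfolding incl_excl_def split using assms
    by (subst sum.insert) (simp_all add: sum.union_disjoint)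
  also have "sum ?g (insert a ` ?P) = (\<Sum>I\<in>?P. - frag_map (inf (x a)) (?g I))"
    unfolding sum.reindex[OF inj] comp_def by (rule sum.cong[OF refl g_insert])
  also have "\<dots> = - frag_map (inf (x a)) (incl_excl x A)"
    unfolding incl_excl_def frag_map_def using assms
    by (simp add: frag_extend_sum comp_def sum_negf)
  finally show ?thesis
    by (simp add: incl_excl_def)
qed

lemma incl_excl_defect_cong:
  assumes "\<And>i. i \<in> A \<Longrightarrow> x i = y i"
  shows "incl_excl_defect x A = incl_excl_defect y A"
proof -
  have "x ` I = y ` I" if "I \<subseteq> A" for I
    using that assms by (intro image_cong) auto
  then show ?thesis
    by (simp add: incl_excl_defect_def incl_excl_def)
qed

lemma incl_excl_defect_singleton [simp]: "incl_excl_defect x {a} = 0"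
  by (simp add: incl_excl_defect_def)

lemma incl_excl_defect_insert:
  assumes "finite A" "A \<noteq> {}" "a \<notin> A"
  shows "incl_excl_defect x (insert a A) =
    modular_defect (x a) (Sup_fin (x ` A)) + incl_excl_defect x A
      - frag_map (inf (x a)) (incl_excl_defect x A)"
  using assms
  by (simp add: incl_excl_defect_def modular_defect_def incl_excl_insert frag_map_diff)

lemma modular_defect_eq_incl_excl_defect:
  assumes "a \<noteq> b"
  shows "modular_defect (x a) (x b) = incl_excl_defect x {a, b}"
  using assms by (simp add: incl_excl_defect_insert frag_map_def)

subsection \<open>The subgroup \<open>J\<close> is an ideal\<close>

abbreviation meet_ring :: "('a::bounded_semilattice_inf_top \<Rightarrow>\<^sub>0 int) ring" where
  "meet_ring \<equiv> int_monoid_ring inf Orderings.top"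

lemma cring_meet_ring: "cring meet_ring"
  by (rule cring_int_monoid_ring) (rule inf_top.comm_monoid_axioms)

lemmas ideal_meet_ring_iff = ideal_int_monoid_ring_iff[OF inf_top.comm_monoid_axioms]

global_interpretation lattice_J: frag_subgroup "lattice_J :: ('a::bounded_lattice \<Rightarrow>\<^sub>0 int) set"
  by (rule frag_subgroup.intro) (rule normal_imp_subgroup[OF lattice_J_normal])

lemma lattice_relations_eq:
  "lattice_relations =
     insert (frag_of bot) {incl_excl_defect x {1..k} | (k::nat) x. k \<ge> 2}"
  unfolding lattice_relations_def incl_excl_defect_def
    incl_excl_by_card[OF finite_atLeastAtMost[of "1::nat"], unfolded card_atLeastAtMost diff_Suc_1]
  by blast

lemma bot_mem_lattice_J: "frag_of bot \<in> lattice_J"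
  unfolding lattice_J_def lattice_relations_eq by (simp add: generate.incl)

lemma incl_excl_defect_mem_lattice_J:
  fixes k :: nat
  assumes "k \<ge> 2"
  shows "incl_excl_defect x {1..k} \<in> lattice_J"
  unfolding lattice_J_def lattice_relations_eq using assms by (intro generate.incl) blast

lemma lattice_J_minimal:
  assumes "frag_subgroup H" "frag_of bot \<in> H"
    and "\<And>x k. k \<ge> (2::nat) \<Longrightarrow> incl_excl_defect x {1..k} \<in> H"
  shows "lattice_J \<subseteq> H"
  unfolding lattice_J_def
  by (rule group.generate_subgroup_incl[OF group_free_Abelian_group])
    (use assms in \<open>auto simp: lattice_relations_eq frag_subgroup_def\<close>)

lemma modular_defect_mem_lattice_J: "modular_defect x y \<in> lattice_J"
proof -
  define z where "z i = (if i = (1::nat) then x else y)" for i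
  have "{1..2::nat} = {1, 2}" by auto
  then have "modular_defect x y = incl_excl_defect z {1..2}"
    using modular_defect_eq_incl_excl_defect[of 1 2 z] by (simp add: z_def)
  then show ?thesis
    by (simp only: incl_excl_defect_mem_lattice_J)
qed

lemma frag_map_inf_mem_lattice_J:
  assumes "c \<in> lattice_J"
  shows "frag_map (inf y) c \<in> lattice_J"
proof -
  have "lattice_J \<subseteq> {c. frag_map (inf y) c \<in> lattice_J}"
  proof (rule lattice_J_minimal)
    show "frag_subgroup {c. frag_map (inf y) c \<in> lattice_J}"
      unfolding frag_map_def by (rule lattice_J.frag_subgroup_vimage)
    show "frag_of bot \<in> {c. frag_map (inf y) c \<in> lattice_J}"
      by (simp add: bot_mem_lattice_J)
  next
    fix x and k :: nat
    assume k: "k \<ge> 2"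
    let ?x' = "x(Suc k := y)" and ?D = "incl_excl_defect x {1..k}" and ?s = "Sup_fin (x ` {1..k})"
    have "incl_excl_defect ?x' {1..Suc k} = modular_defect y ?s + ?D - frag_map (inf y) ?D"
      using k incl_excl_defect_cong[of "{1..k}" ?x' x]
      by (simp add: atLeastAtMostSuc_conv incl_excl_defect_insert)
    then have "frag_map (inf y) ?D =
        modular_defect y ?s + ?D - incl_excl_defect ?x' {1..Suc k}"
      by simp
    also have "\<dots> \<in> lattice_J"
      using k by (intro lattice_J.diff_mem lattice_J.add_mem modular_defect_mem_lattice_J
          incl_excl_defect_mem_lattice_J) simp_all
    finally show "?D \<in> {c. frag_map (inf y) c \<in> lattice_J}"
      by simp
  qed
  then show ?thesis
    using assms by blast
qed

lemma ideal_lattice_J: "ideal lattice_J meet_ring"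
  unfolding ideal_meet_ring_iff
  by (simp add: lattice_J.frag_subgroup_axioms frag_map_inf_mem_lattice_J)

lemma lattice_J_subset_ideal:
  assumes H: "ideal H meet_ring" and "frag_of bot \<in> H" and "\<And>x y. modular_defect x y \<in> H"
  shows "lattice_J \<subseteq> H"
proof (rule lattice_J_minimal)
  show sub: "frag_subgroup H"
    using H by (rule ideal_imp_frag_subgroup)
  interpret frag_subgroup H by (rule sub)
  have "incl_excl_defect x A \<in> H" if "finite A" "A \<noteq> {}" for x :: "nat \<Rightarrow> 'a" and A
    using that
  proof (induction rule: finite_ne_induct)
    case (insert a A)
    moreover have "frag_map (inf (x a)) (incl_excl_defect x A) \<in> H"
      using insert.IH H unfolding ideal_meet_ring_iff by blast
    ultimately show ?case
      by (simp add: incl_excl_defect_insert add_mem diff_mem assms)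
  qed (simp add: zero_mem)
  then show "incl_excl_defect x {1..k} \<in> H" if "k \<ge> 2" for x and k :: nat
    using that by simp
qed (rule assms)

subsection \<open>The polynomial ring and the ideal \<open>I\<close>\<close>

lemma int_mpoly_ring_eq: "int_mpoly_ring = int_monoid_ring (+) 0"
  by (simp add: int_mpoly_ring_def ring_of_type_algebra_def int_monoid_ring_def
      times_eq_frag_map2 fun_eq_iff)

lemma cring_int_mpoly_ring: "cring int_mpoly_ring"
  unfolding int_mpoly_ring_def by (rule cring_from_type_algebra)

lemma int_mpoly_ring_simps [simp]:
  "carrier int_mpoly_ring = UNIV" "p \<otimes>\<^bsub>int_mpoly_ring\<^esub> q = p * q"
  by (simp_all add: int_mpoly_ring_def ring_of_type_algebra_def)

lemma ideal_lattice_ideal: "ideal lattice_ideal int_mpoly_ring"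
  unfolding lattice_ideal_def
  by (rule ring.genideal_ideal) (simp_all add: cring.axioms(1)[OF cring_int_mpoly_ring])

lemma lattice_ideal_mult: "p \<in> lattice_ideal \<Longrightarrow> q * p \<in> lattice_ideal"
  using ideal.I_l_closed[OF ideal_lattice_ideal, of p q] by simp

global_interpretation lattice_ideal:
    frag_subgroup "lattice_ideal :: 'a::bounded_lattice int_mpoly set"
  by (rule ideal_imp_frag_subgroup) (rule ideal_lattice_ideal[unfolded int_mpoly_ring_eq])

lemma
  shows lattice_ideal_bot: "int_var bot \<in> lattice_ideal"
    and lattice_ideal_top: "int_var Orderings.top - 1 \<in> lattice_ideal"
    and lattice_ideal_inf: "int_var (inf x y) - int_var x * int_var y \<in> lattice_ideal"
    and lattice_ideal_sup:
      "int_var (sup x y) - int_var x - int_var y + int_var x * int_var y \<in> lattice_ideal"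
  unfolding lattice_ideal_def
  by (rule subsetD[OF ring.genideal_self[OF cring.axioms(1)[OF cring_int_mpoly_ring]]]; force)+

definition monomial_meet :: "('a::bounded_semilattice_inf_top \<Rightarrow>\<^sub>0 nat) \<Rightarrow> 'a" where
  "monomial_meet m = Inf_fin (insert Orderings.top (Poly_Mapping.keys m))"

lemma monomial_meet_add: "monomial_meet (m + n) = inf (monomial_meet m) (monomial_meet n)"
proof -
  have "insert Orderings.top (Poly_Mapping.keys (m + n)) =
      insert Orderings.top (Poly_Mapping.keys m) \<union> insert Orderings.top (Poly_Mapping.keys n)"
    by (auto simp: in_keys_iff lookup_add)
  then show ?thesis
    unfolding monomial_meet_def by (simp only:) (rule Inf_fin.union; simp)
qed

lemma monomial_meet_zero [simp]: "monomial_meet 0 = Orderings.top"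
  by (simp add: monomial_meet_def)

lemma monomial_meet_single [simp]: "n > 0 \<Longrightarrow> monomial_meet (Poly_Mapping.single x n) = x"
  by (simp add: monomial_meet_def)

lemma frag_map_monomial_meet_int_var [simp]: "frag_map monomial_meet (int_var x) = frag_of x"
  by (simp add: int_var_def)

lemma frag_map_monomial_meet_frag_extend_int_var:
  "frag_map monomial_meet (frag_extend int_var c) = c"
  by (simp add: frag_map_frag_extend flip: frag_expansion)

lemma ring_hom_ring_monomial_meet: "ring_hom_ring int_mpoly_ring meet_ring (frag_map monomial_meet)"
  unfolding int_mpoly_ring_eq
  by (intro ring_hom_ring_frag_map add.comm_monoid_axioms inf_top.comm_monoid_axioms
      monomial_meet_zero monomial_meet_add)

lemma poly_mapping_nat_induct [case_names zero add_single]: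
  fixes m :: "'a \<Rightarrow>\<^sub>0 nat"
  assumes "P 0" and "\<And>x m. P m \<Longrightarrow> P (Poly_Mapping.single x 1 + m)"
  shows "P m"
proof (induction m rule: update_induct)
  case (update m x b)
  have "P (Poly_Mapping.single x n + m)" for n
  proof (induction n)
    case (Suc n)
    then show ?case
      using assms(2)[of "Poly_Mapping.single x n + m" x]
      by (simp flip: add.assoc single_add)
  qed (simp add: update.IH)
  moreover have "Poly_Mapping.update x b m = Poly_Mapping.single x b + m"
    using update.hyps
    by (intro poly_mapping_eqI) (auto simp: lookup_update lookup_add lookup_single in_keys_iff)
  ultimately show ?case
    by simp
qed (rule assms)

lemma monomial_diff_int_var_mem_lattice_ideal:
  "frag_of m - int_var (monomial_meet m) \<in> lattice_ideal"
proof (induction m rule: poly_mapping_nat_induct)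
  case zero
  show ?case
    using lattice_ideal.uminus_mem[OF lattice_ideal_top] by simp
next
  case (add_single x m)
  let ?y = "monomial_meet m"
  have "frag_of (Poly_Mapping.single x 1 + m) = int_var x * frag_of m"
    by (simp add: int_var_def mult_single)
  then have "frag_of (Poly_Mapping.single x 1 + m) - int_var (inf x ?y) =
      int_var x * (frag_of m - int_var ?y) - (int_var (inf x ?y) - int_var x * int_var ?y)"
    by (simp add: algebra_simps)
  also have "\<dots> \<in> lattice_ideal"
    by (intro lattice_ideal.diff_mem lattice_ideal_mult add_single.IH lattice_ideal_inf)
  finally show ?case
    by (simp add: monomial_meet_add)
qed

lemma poly_diff_linear_mem_lattice_ideal:
  "p - frag_extend int_var (frag_map monomial_meet p) \<in> lattice_ideal"
  using lattice_ideal.frag_extend_diff_mem[where f = frag_of,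
      OF monomial_diff_int_var_mem_lattice_ideal]
  by (simp add: frag_extend_frag_map flip: frag_expansion)

lemma ideal_vimage_frag_extend_int_var:
  "ideal {c :: 'a::bounded_lattice \<Rightarrow>\<^sub>0 int. frag_extend int_var c \<in> lattice_ideal} meet_ring"
  unfolding ideal_meet_ring_iff
proof (intro conjI allI ballI)
  show "frag_subgroup {c. frag_extend int_var c \<in> lattice_ideal}"
    by (rule lattice_ideal.frag_subgroup_vimage)
next
  fix x :: 'a and c :: "'a \<Rightarrow>\<^sub>0 int"
  assume "c \<in> {c. frag_extend int_var c \<in> lattice_ideal}"
  then have "int_var x * frag_extend int_var c \<in> lattice_ideal"
    by (simp add: lattice_ideal_mult)
  moreover have "frag_extend int_var (frag_map (inf x) c) - int_var x * frag_extend int_var c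
      \<in> lattice_ideal"
    unfolding frag_extend_frag_map frag_extend_mult_left[symmetric]
    by (intro lattice_ideal.frag_extend_diff_mem lattice_ideal_inf)
  ultimately show "frag_map (inf x) c \<in> {c. frag_extend int_var c \<in> lattice_ideal}"
    by (simp add: lattice_ideal.diff_mem_imp_mem_iff)
qed

lemma frag_extend_int_var_mem_lattice_ideal:
  assumes "c \<in> lattice_J"
  shows "frag_extend int_var c \<in> lattice_ideal"
proof -
  have "frag_extend int_var (modular_defect x y) \<in> lattice_ideal" for x y :: 'a
    using lattice_ideal.add_mem[OF lattice_ideal_sup lattice_ideal_inf, of x y x y]
    by (simp add: modular_defect_def frag_extend_add frag_extend_diff algebra_simps)
  then show ?thesis
    using assms lattice_J_subset_ideal[OF ideal_vimage_frag_extend_int_var] lattice_ideal_bot by auto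
qed

lemma lattice_ideal_eq_vimage_lattice_J:
  "lattice_ideal = {p :: 'a::bounded_lattice int_mpoly. frag_map monomial_meet p \<in> lattice_J}"
    (is "_ = ?K")
proof
  interpret h: ring_hom_ring int_mpoly_ring meet_ring
    "frag_map monomial_meet :: 'a int_mpoly \<Rightarrow> ('a \<Rightarrow>\<^sub>0 int)"
    by (rule ring_hom_ring_monomial_meet)
  have map_one: "frag_map monomial_meet (1 :: 'a int_mpoly) = frag_of Orderings.top"
    by (simp flip: single_one)
  have map_mult: "frag_map monomial_meet (int_var x * int_var y) = frag_of (inf x y)" for x y :: 'a
    using h.hom_mult[of "int_var x" "int_var y"] by simp
  show "lattice_ideal \<subseteq> ?K"
    unfolding lattice_ideal_def
  proof (rule h.R.genideal_minimal)
    show "ideal ?K int_mpoly_ring"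
      using h.ideal_vimage[OF ideal_lattice_J] by simp
  qed (auto simp: frag_map_add frag_map_diff map_one map_mult bot_mem_lattice_J lattice_J.zero_mem
      modular_defect_mem_lattice_J[unfolded modular_defect_def])
  show "?K \<subseteq> lattice_ideal"
    using lattice_ideal.diff_mem_imp_mem_iff[OF poly_diff_linear_mem_lattice_ideal]
    by (auto intro: frag_extend_int_var_mem_lattice_ideal)
qed

subsection \<open>The ring structure on \<open>M(X)\<close>\<close>

abbreviation lattice_M_proj :: "('a::bounded_lattice \<Rightarrow>\<^sub>0 int) \<Rightarrow> ('a \<Rightarrow>\<^sub>0 int) set" where
  "lattice_M_proj c \<equiv> lattice_J #>\<^bsub>free_Abelian_group UNIV\<^esub> c"

lemma carrier_lattice_M: "carrier lattice_M = range lattice_M_proj"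
  by (auto simp: lattice_M_def carrier_FactGroup)

lemma meet_ring_structure_Quot:
  "meet_ring_structure (meet_ring Quot lattice_J :: ('a::bounded_lattice \<Rightarrow>\<^sub>0 int) set ring)"
  unfolding meet_ring_structure_def
proof (intro conjI allI)
  interpret J: ideal lattice_J "meet_ring :: ('a \<Rightarrow>\<^sub>0 int) ring" by (rule ideal_lattice_J)
  have proj: "lattice_J +>\<^bsub>meet_ring\<^esub> c = lattice_M_proj c" for c :: "'a \<Rightarrow>\<^sub>0 int"
    unfolding a_r_coset_def add_monoid_int_monoid_ring ..
  show "cring (meet_ring Quot lattice_J :: ('a \<Rightarrow>\<^sub>0 int) set ring)"
    using cring_meet_ring by (rule J.quotient_is_cring)
  show "add_monoid (meet_ring Quot lattice_J) = lattice_M"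
    unfolding FactRing_def A_RCOSETS_def set_add_def add_monoid_int_monoid_ring
    by (simp add: lattice_M_def FactGroup_def)
  show "lattice_M_class x \<otimes>\<^bsub>meet_ring Quot lattice_J\<^esub> lattice_M_class y = lattice_M_class (inf x y)"
    for x y :: 'a
    using J.rcoset_mult_add[of "frag_of x" "frag_of y"]
    by (simp add: lattice_M_class_def proj FactRing_def)
qed

locale lattice_M_ring =
  fixes R :: "('a::bounded_lattice \<Rightarrow>\<^sub>0 int) set ring" (structure)
  assumes meet_ring_structure: "meet_ring_structure R"

sublocale lattice_M_ring \<subseteq> cring R
  using meet_ring_structure by (simp add: meet_ring_structure_def)

context lattice_M_ring
begin

lemma add_monoid_eq: "add_monoid R = lattice_M"
  using meet_ring_structure by (simp add: meet_ring_structure_def)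

lemma carrier_eq: "carrier R = range lattice_M_proj"
  using arg_cong[OF add_monoid_eq, of carrier] by (simp add: carrier_lattice_M)

lemma proj_closed [simp]: "lattice_M_proj c \<in> carrier R"
  by (simp add: carrier_eq)

lemma proj_add: "lattice_M_proj (a + b) = lattice_M_proj a \<oplus> lattice_M_proj b"
  using arg_cong[OF add_monoid_eq, of monoid.mult] normal.rcos_sum[OF lattice_J_normal, of a b]
  by (simp add: lattice_M_def FactGroup_def)

lemma proj_zero: "lattice_M_proj 0 = \<zero>"
  using proj_add[of 0 0] by (metis add.l_cancel_one' add_0 proj_closed)

lemma proj_diff: "lattice_M_proj (a - b) = lattice_M_proj a \<ominus> lattice_M_proj b"
proof -
  have "lattice_M_proj (- b) = \<ominus> lattice_M_proj b"
    by (rule minus_equality[symmetric]) (simp_all add: proj_zero flip: proj_add)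
  then show ?thesis
    using proj_add[of a "- b"] by (simp add: a_minus_def)
qed

lemma proj_eq_zero_iff: "lattice_M_proj c = \<zero> \<longleftrightarrow> c \<in> lattice_J"
  using lattice_J.rcoset_eq_iff[of c 0] by (simp add: proj_zero)

lemma proj_mult: "lattice_M_proj (frag_map2 inf a b) = lattice_M_proj a \<otimes> lattice_M_proj b"
proof (rule frag_induction[of a UNIV])
  show "lattice_M_proj (frag_map2 inf 0 b) = lattice_M_proj 0 \<otimes> lattice_M_proj b"
    by (simp add: frag_map2_def proj_zero)
next
  fix x
  show "lattice_M_proj (frag_map2 inf (frag_of x) b) = lattice_M_proj (frag_of x) \<otimes> lattice_M_proj b"
  proof (rule frag_induction[of b UNIV])
    show "lattice_M_proj (frag_map2 inf (frag_of x) 0) = lattice_M_proj (frag_of x) \<otimes> lattice_M_proj 0"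
      by (simp add: frag_map_def proj_zero)
    show "lattice_M_proj (frag_map2 inf (frag_of x) (frag_of y)) =
        lattice_M_proj (frag_of x) \<otimes> lattice_M_proj (frag_of y)" for y
      using meet_ring_structure by (simp add: meet_ring_structure_def lattice_M_class_def)
  qed (auto simp: frag_map_diff proj_diff a_minus_def r_distr r_minus)
qed (auto simp: frag_map2_diff_left proj_diff a_minus_def l_distr l_minus)

lemma one_eq: "\<one> = lattice_M_proj (frag_of Orderings.top)"
proof -
  obtain e where e: "\<one> = lattice_M_proj e"
    using one_closed by (auto simp: carrier_eq)
  have "lattice_M_proj (frag_of Orderings.top) = lattice_M_proj (frag_of Orderings.top) \<otimes> \<one>"
    by simp
  also have "\<dots> = lattice_M_proj (frag_map2 inf (frag_of Orderings.top) e)"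
    by (simp only: e proj_mult)
  also have "\<dots> = \<one>"
    by (simp add: e frag_map_eq_self)
  finally show ?thesis ..
qed

lemma ring_hom_ring_proj: "ring_hom_ring meet_ring R lattice_M_proj"
  by (rule ring_hom_ringI)
    (simp_all add: cring.axioms(1)[OF cring_meet_ring] ring_axioms proj_add proj_mult one_eq)

lemma ring_hom_ring_int_mpoly:
  "ring_hom_ring int_mpoly_ring R (\<lambda>p. lattice_M_proj (frag_map monomial_meet p))"
proof (rule ring_hom_ringI2)
  interpret pi: ring_hom_ring meet_ring R lattice_M_proj
    by (rule ring_hom_ring_proj)
  interpret h: ring_hom_ring int_mpoly_ring meet_ring "frag_map monomial_meet :: _ \<Rightarrow> ('a \<Rightarrow>\<^sub>0 int)"
    by (rule ring_hom_ring_monomial_meet)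
  show "ring (int_mpoly_ring :: 'a int_mpoly ring)" "ring R"
    by (rule h.R.ring_axioms, rule ring_axioms)
  show "(\<lambda>p. lattice_M_proj (frag_map monomial_meet p)) \<in> ring_hom int_mpoly_ring R"
    using ring_hom_trans[OF h.homh pi.homh] unfolding comp_def .
qed

lemma a_kernel_int_mpoly:
  "a_kernel int_mpoly_ring R (\<lambda>p. lattice_M_proj (frag_map monomial_meet p)) = lattice_ideal"
  by (simp add: a_kernel_def' lattice_ideal_eq_vimage_lattice_J proj_eq_zero_iff)

lemma iso_int_mpoly_Quot: "R \<simeq> int_mpoly_ring Quot (lattice_ideal :: 'a int_mpoly set)"
proof -
  have "range (\<lambda>p. lattice_M_proj (frag_map monomial_meet p)) =
      lattice_M_proj ` range (frag_map monomial_meet)"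
    by (simp only: image_image)
  also have "range (frag_map monomial_meet) = (UNIV :: ('a \<Rightarrow>\<^sub>0 int) set)"
    by (rule surjI) (rule frag_map_monomial_meet_frag_extend_int_var)
  finally have "int_mpoly_ring Quot (lattice_ideal :: 'a int_mpoly set) \<simeq> R"
    using ring_hom_ring.FactRing_iso[OF ring_hom_ring_int_mpoly]
    by (simp add: a_kernel_int_mpoly carrier_eq)
  then show ?thesis
    by (rule ring_iso_sym[OF ideal.quotient_is_ring[OF ideal_lattice_ideal]])
qed

end

lemma meet_ring_structure_one_unique:
  assumes "meet_ring_structure R" "meet_ring_structure S"
  shows "\<one>\<^bsub>R\<^esub> = \<one>\<^bsub>S\<^esub>"
  using assms by (simp add: lattice_M_ring.one_eq lattice_M_ring.intro)

lemma meet_ring_structure_mult_unique: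
  assumes "meet_ring_structure R" "meet_ring_structure S"
    and "C \<in> carrier lattice_M" "D \<in> carrier lattice_M"
  shows "C \<otimes>\<^bsub>R\<^esub> D = C \<otimes>\<^bsub>S\<^esub> D"
  using assms
  by (auto simp: carrier_lattice_M simp flip: lattice_M_ring.proj_mult[OF lattice_M_ring.intro])

subsection \<open>Functoriality\<close>

lemma ring_hom_ring_bounded_lattice_hom:
  assumes "bounded_lattice_hom f"
  shows "ring_hom_ring meet_ring meet_ring (frag_map f)"
  using assms unfolding bounded_lattice_hom_def
  by (intro ring_hom_ring_frag_map inf_top.comm_monoid_axioms) simp_all

lemma frag_map_mem_lattice_J:
  assumes f: "bounded_lattice_hom f" and "c \<in> lattice_J"
  shows "frag_map f c \<in> lattice_J"
proof -
  have "ideal {c. frag_map f c \<in> lattice_J} meet_ring"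
    using ring_hom_ring.ideal_vimage[OF ring_hom_ring_bounded_lattice_hom[OF f] ideal_lattice_J] by simp
  moreover have "frag_map f (modular_defect x y) = modular_defect (f x) (f y)" for x y
    using f by (simp add: modular_defect_def frag_map_add frag_map_diff bounded_lattice_hom_def)
  moreover have "f bot = bot"
    using f by (simp add: bounded_lattice_hom_def)
  ultimately have "lattice_J \<subseteq> {c. frag_map f c \<in> lattice_J}"
    by (intro lattice_J_subset_ideal) (simp_all add: bot_mem_lattice_J modular_defect_mem_lattice_J)
  then show ?thesis
    using assms(2) by blast
qed

lemma lattice_M_map_proj:
  assumes f: "bounded_lattice_hom f"
  shows "lattice_M_map f (lattice_M_proj c) = lattice_M_proj (frag_map f c)"
proof -
  have "lattice_M_proj (frag_map f d) = lattice_M_proj (frag_map f c)"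
    if "d \<in> lattice_M_proj c" for d
  proof -
    have "d - c \<in> lattice_J"
      using that by (auto simp: r_coset_def)
    then show ?thesis
      by (simp add: lattice_J.rcoset_eq_iff frag_map_mem_lattice_J[OF f] flip: frag_map_diff)
  qed
  moreover have "c \<in> lattice_M_proj c"
    using lattice_J.zero_mem by (force simp: r_coset_def)
  ultimately show ?thesis
    unfolding lattice_M_map_def frag_map_def[symmetric] by blast
qed

lemma lattice_M_map_class:
  "bounded_lattice_hom f \<Longrightarrow> lattice_M_map f (lattice_M_class x) = lattice_M_class (f x)"
  by (simp add: lattice_M_class_def lattice_M_map_proj)

lemma lattice_M_map_ring_hom:
  assumes f: "bounded_lattice_hom f" and "meet_ring_structure R" "meet_ring_structure R'"
  shows "lattice_M_map f \<in> ring_hom R R'"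
proof -
  interpret R: lattice_M_ring R by standard fact
  interpret R': lattice_M_ring R' by standard fact
  interpret h: ring_hom_ring meet_ring meet_ring "frag_map f"
    using f by (rule ring_hom_ring_bounded_lattice_hom)
  show ?thesis
    using h.hom_mult h.hom_one
    by (intro ring_hom_memI)
      (auto simp: R.carrier_eq R.one_eq R'.one_eq lattice_M_map_proj[OF f] frag_map_add
        R'.proj_add R'.proj_mult simp flip: R.proj_add R.proj_mult)
qed

lemma lattice_M_map_id:
  assumes "C \<in> carrier lattice_M"
  shows "lattice_M_map (id :: 'a::bounded_lattice \<Rightarrow> 'a) C = C"
proof -
  have "bounded_lattice_hom (id :: 'a \<Rightarrow> 'a)"
    by (simp add: bounded_lattice_hom_def)
  then show ?thesis
    using assms by (auto simp: carrier_lattice_M lattice_M_map_proj frag_map_eq_self)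
qed

lemma lattice_M_map_comp:
  assumes f: "bounded_lattice_hom f" and g: "bounded_lattice_hom g" and "C \<in> carrier lattice_M"
  shows "lattice_M_map (g \<circ> f) C = lattice_M_map g (lattice_M_map f C)"
proof -
  have "bounded_lattice_hom (g \<circ> f)"
    using f g by (simp add: bounded_lattice_hom_def)
  then show ?thesis
    using assms by (auto simp: carrier_lattice_M lattice_M_map_proj frag_map_frag_map comp_def)
qed

theorem theorem9:
  shows
    "(\<exists>R :: ('a::bounded_lattice \<Rightarrow>\<^sub>0 int) set ring. meet_ring_structure R) \<and>
     (\<forall>R S :: ('a \<Rightarrow>\<^sub>0 int) set ring. meet_ring_structure R \<longrightarrow> meet_ring_structure S \<longrightarrow>
        \<one>\<^bsub>R\<^esub> = \<one>\<^bsub>S\<^esub> \<and>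
        (\<forall>C\<in>carrier lattice_M. \<forall>D\<in>carrier lattice_M. C \<otimes>\<^bsub>R\<^esub> D = C \<otimes>\<^bsub>S\<^esub> D)) \<and>
     (\<forall>R :: ('a \<Rightarrow>\<^sub>0 int) set ring. meet_ring_structure R \<longrightarrow>
        R \<simeq> int_mpoly_ring Quot (lattice_ideal :: 'a int_mpoly set)) \<and>
     (\<forall>(f :: 'a \<Rightarrow> 'b::bounded_lattice) R R'.
        bounded_lattice_hom f \<longrightarrow> meet_ring_structure R \<longrightarrow> meet_ring_structure R' \<longrightarrow>
        lattice_M_map f \<in> ring_hom R R' \<and>
        (\<forall>x. lattice_M_map f (lattice_M_class x) = lattice_M_class (f x))) \<and>
     (\<forall>C\<in>carrier lattice_M. lattice_M_map (id :: 'a \<Rightarrow> 'a) C = C) \<and>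
     (\<forall>(f :: 'a \<Rightarrow> 'b) (g :: 'b \<Rightarrow> 'c::bounded_lattice).
        bounded_lattice_hom f \<longrightarrow> bounded_lattice_hom g \<longrightarrow>
        (\<forall>C\<in>carrier lattice_M. lattice_M_map (g \<circ> f) C = lattice_M_map g (lattice_M_map f C)))"
proof (intro conjI allI impI ballI)
  show "\<exists>R :: ('a \<Rightarrow>\<^sub>0 int) set ring. meet_ring_structure R"
    using meet_ring_structure_Quot by blast
next
  fix R S :: "('a \<Rightarrow>\<^sub>0 int) set ring"
  assume "meet_ring_structure R" "meet_ring_structure S"
  then show "\<one>\<^bsub>R\<^esub> = \<one>\<^bsub>S\<^esub>"
    by (rule meet_ring_structure_one_unique)
next
  fix R S :: "('a \<Rightarrow>\<^sub>0 int) set ring" and C D :: "('a \<Rightarrow>\<^sub>0 int) set"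
  assume "meet_ring_structure R" "meet_ring_structure S"
    and "C \<in> carrier lattice_M" "D \<in> carrier lattice_M"
  then show "C \<otimes>\<^bsub>R\<^esub> D = C \<otimes>\<^bsub>S\<^esub> D"
    by (rule meet_ring_structure_mult_unique)
next
  fix R :: "('a \<Rightarrow>\<^sub>0 int) set ring"
  assume "meet_ring_structure R"
  then show "R \<simeq> int_mpoly_ring Quot (lattice_ideal :: 'a int_mpoly set)"
    by (intro lattice_M_ring.iso_int_mpoly_Quot lattice_M_ring.intro)
qed (rule lattice_M_map_ring_hom lattice_M_map_class lattice_M_map_id lattice_M_map_comp; assumption)+

end
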